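(* Let $p$ be an odd prime. The set of pairs $(a,b)$, with $a=(a_0,\dots,a_{p-1})\in\mathbb{F}_p^p$ and $b=(b_0,\dots,b_{p-1})\in\mathbb{F}_p^p$, satisfying $$0=a_0b_\ell+\sum_{\substack{0\le j,k<p\\ j+k\equiv\ell\ (\mathrm{mod}\ p)}}b_k\left(-\binom{j+1}{2}b_j+j\,a_j\right)\qquad\text{for each }\ell=0,1,\dots,p-1$$ has cardinality $p^{p+1}$.
   Context: All integers and binomial coefficients are read in $\mathbb{F}_p$. (In the paper, $a$ and $b$ are regarded as elements $a=\sum_j a_jg^j$, $b=\sum_j b_jg^j$ of the group algebra $\mathbb{F}_pG$ of a cyclic group $G=\langle g\rangle$ of order $p$.) *)

theory Defs
  imports "Berlekamp_Zassenhaus.Finite_Field" "HOL-Library.FuncSet"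
begin

text \<open>
  The field with \<open>p\<close> elements is \<^typ>\<open>'p mod_ring\<close> for an index type \<^typ>\<open>'p::prime_card\<close>
  with \<open>p = CARD('p)\<close>. The class \<^class>\<open>prime_card\<close> says exactly that this cardinality is prime.
  A vector in its \<open>p\<close>-th power is an extensional function on \<open>{..<p}\<close>, so that
  distinct functions are distinct vectors and cardinalities are the intended ones.
\<close>

end

theory Submission
  imports Defs
begin

text \<open>
  Read \<open>b\<close> as the class of \<open>\<Sum>k. b\<^sub>k X\<^sup>k\<close> in \<open>R = F[X] / (X\<^sup>p - 1)\<close>, where \<open>F\<close> is the field
  with \<open>p\<close> elements. The sum over \<open>j + k \<equiv> l\<close> is then the coefficient of \<open>X\<^sup>l\<close> in a product in
  \<open>R\<close>, and \<open>a\<^sub>0 b\<^sub>l\<close> is the coefficient of \<open>X\<^sup>l\<close> in the product of \<open>b\<close> and the constant \<open>a\<^sub>0\<close>. So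
  the whole system is the single equation \<open>b c = 0\<close> in \<open>R\<close>, where \<open>c\<close> has the coefficients
  \<open>c\<^sub>0 = a\<^sub>0\<close> and \<open>c\<^sub>j = j a\<^sub>j - (j + 1 choose 2) b\<^sub>j\<close> for \<open>0 < j < p\<close>.

  The term \<open>a\<^sub>0 b\<^sub>l\<close> is what makes the count easy: the map \<open>a \<mapsto> \<Sum>j. j a\<^sub>j X\<^sup>j\<close> kills only the
  coefficient \<open>a\<^sub>0\<close>, and adding \<open>a\<^sub>0\<close> repairs this. For every fixed \<open>b\<close> the map \<open>a \<mapsto> c\<close> is
  therefore a bijection, since \<open>1, \<dots>, p - 1\<close> are invertible modulo \<open>p\<close>
  (\<open>bij_betw_cofactor_vec\<close>), and it remains to count the pairs \<open>(b, c)\<close> with \<open>b c = 0\<close>.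

  In characteristic \<open>p\<close> one has \<open>X\<^sup>p - 1 = (X - 1)\<^sup>p\<close>, so that \<open>R\<close> is a chain ring. For each
  \<open>v < p\<close> there are \<open>p\<^bsup>p-v\<^esup> - p\<^bsup>p-v-1\<^esup>\<close> elements \<open>b\<close> vanishing at 1 to order exactly \<open>v\<close>,
  each annihilated by the \<open>p\<^sup>v\<close> multiples of \<open>(X - 1)\<^bsup>p-v\<^esup>\<close>; the product \<open>p\<^sup>p - p\<^bsup>p-1\<^esup>\<close> does
  not depend on \<open>v\<close>. With the \<open>p\<^sup>p\<close> pairs for \<open>b = 0\<close> the total is
  \<open>p\<^sup>p + p (p\<^sup>p - p\<^bsup>p-1\<^esup>) = p\<^bsup>p+1\<^esup>\<close> (\<open>card_pairs_linear_power_dvd_mult\<close>).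
\<close>

section \<open>Polynomials of bounded degree\<close>

text \<open>
  The zero polynomial is listed separately because it has degree 0, so that for \<open>n = 0\<close> the set is
  \<open>{0}\<close> and the cardinality \<open>q\<^sup>n\<close> is right for every \<open>n\<close>.
\<close>
definition polys_below :: "nat \<Rightarrow> 'a::zero poly set" where
  "polys_below n = {f. f = 0 \<or> degree f < n}"

definition poly_of_vec :: "nat \<Rightarrow> (nat \<Rightarrow> 'a) \<Rightarrow> 'a::comm_monoid_add poly" where
  "poly_of_vec n v = (\<Sum>i<n. monom (v i) i)"

lemma coeff_poly_of_vec: "coeff (poly_of_vec n v) i = (if i < n then v i else 0)"
  by (simp add: poly_of_vec_def coeff_sum coeff_monom)

lemma polys_below_iff_coeff: "f \<in> polys_below n \<longleftrightarrow> (\<forall>i\<ge>n. coeff f i = 0)"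
proof
  assume "\<forall>i\<ge>n. coeff f i = 0"
  then have "f = 0 \<or> degree f < n"
    using leading_coeff_0_iff not_le by metis
  then show "f \<in> polys_below n" by (simp add: polys_below_def)
qed (auto simp: polys_below_def coeff_eq_0)

lemma poly_of_vec_in_polys_below: "poly_of_vec n v \<in> polys_below n"
  by (simp add: polys_below_iff_coeff coeff_poly_of_vec)

lemma bij_betw_poly_of_vec:
  "bij_betw (poly_of_vec n) ({..<n} \<rightarrow>\<^sub>E UNIV) (polys_below n :: 'a::comm_monoid_add poly set)"
proof (rule bij_betw_byWitness[where f' = "\<lambda>f. restrict (coeff f) {..<n}"])
  show "\<forall>v\<in>{..<n} \<rightarrow>\<^sub>E UNIV. restrict (coeff (poly_of_vec n v)) {..<n} = v"
    by (auto simp: coeff_poly_of_vec fun_eq_iff PiE_def extensional_def restrict_def)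
  show "\<forall>f\<in>polys_below n. poly_of_vec n (restrict (coeff f) {..<n}) = (f :: 'a poly)"
    by (auto simp: coeff_poly_of_vec poly_eq_iff polys_below_iff_coeff)
  show "poly_of_vec n ` ({..<n} \<rightarrow>\<^sub>E UNIV) \<subseteq> (polys_below n :: 'a poly set)"
    by (simp add: image_subset_iff poly_of_vec_in_polys_below)
  show "(\<lambda>f. restrict (coeff f) {..<n}) ` polys_below n \<subseteq> {..<n} \<rightarrow>\<^sub>E (UNIV :: 'a set)"
    by (simp add: image_subset_iff)
qed

lemma card_polys_below:
  "card (polys_below n :: 'a::{comm_monoid_add,finite} poly set) = CARD('a) ^ n"
  using bij_betw_same_card[OF bij_betw_poly_of_vec[of n, where 'a = 'a]] by (simp add: card_PiE)

lemma finite_polys_below [simp]: "finite (polys_below n :: 'a::{comm_monoid_add,finite} poly set)"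
  using bij_betw_finite[OF bij_betw_poly_of_vec[of n, where 'a = 'a]] by (simp add: finite_PiE)

section \<open>Pairs whose product is divisible by a power of a linear polynomial\<close>

text \<open>The cofactor in \<open>f = (X - r)\<^sup>v h\<close> ranges freely over the polynomials of degree below \<open>n - v\<close>.\<close>
lemma card_polys_below_multiples:
  fixes r :: "'a::{field,finite}"
  assumes "v \<le> n"
  shows "card {f \<in> polys_below n. [:-r, 1:] ^ v dvd f} = CARD('a) ^ (n - v)"
proof -
  let ?q = "[:-r, 1:] ^ v"
  have deg: "degree (?q * h) = v + degree h" if "h \<noteq> 0" for h
    using that by (simp add: degree_mult_eq degree_linear_power)
  have "{f \<in> polys_below n. ?q dvd f} = (\<lambda>h. ?q * h) ` polys_below (n - v)"
  proof (intro equalityI subsetI)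
    fix f assume "f \<in> {f \<in> polys_below n. ?q dvd f}"
    then obtain h where h: "f = ?q * h" and f: "f \<in> polys_below n" by (auto elim: dvdE)
    have "h \<in> polys_below (n - v)"
    proof (cases "h = 0")
      case False
      then show ?thesis using f deg[OF False] by (auto simp: h polys_below_def)
    qed (simp add: polys_below_def)
    then show "f \<in> (\<lambda>h. ?q * h) ` polys_below (n - v)" using h by blast
  next
    fix f assume "f \<in> (\<lambda>h. ?q * h) ` polys_below (n - v)"
    then obtain h where h: "f = ?q * h" "h \<in> polys_below (n - v)" by blast
    then show "f \<in> {f \<in> polys_below n. ?q dvd f}"
      using deg[of h] by (cases "h = 0") (auto simp: polys_below_def)
  qed
  moreover have "inj_on (\<lambda>h. ?q * h) (polys_below (n - v))"
    by (auto simp: inj_on_def)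
  ultimately show ?thesis by (simp add: card_image card_polys_below)
qed

text \<open>
  The order at \<open>r\<close> is additive on products of nonzero polynomials over a domain, so \<open>g\<close> has to supply
  exactly the factors \<open>X - r\<close> that \<open>f\<close> lacks. When \<open>f\<close> alone has enough of them, the truncated
  subtraction makes the condition on \<open>g\<close> trivial, as it should be.
\<close>
lemma linear_power_dvd_mult_iff:
  fixes f g :: "'a::idom poly"
  assumes "f \<noteq> 0"
  shows "[:-r, 1:] ^ n dvd f * g \<longleftrightarrow> [:-r, 1:] ^ (n - order r f) dvd g"
  using assms by (cases "g = 0") (auto simp: order_divides order_mult)

text \<open>
  Sort the pairs by the order \<open>v\<close> of \<open>f\<close> at \<open>r\<close>. The number of \<open>f\<close> of order \<open>v\<close> shrinks with \<open>v\<close> by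
  the same power of \<open>q = CARD('a)\<close> by which the number of admissible \<open>g\<close> grows, so each of the \<open>n\<close> orders
  contributes equally; \<open>f = 0\<close> admits every \<open>g\<close>. The subtraction is on natural numbers but
  never truncates.
\<close>
lemma card_pairs_linear_power_dvd_mult:
  fixes r :: "'a::{field,finite}"
  shows "card {(f, g). f \<in> polys_below n \<and> g \<in> polys_below n \<and> [:-r, 1:] ^ n dvd f * g}
       = CARD('a) ^ n + n * (CARD('a) ^ n - CARD('a) ^ (n - 1))"
proof -
  let ?P = "polys_below n :: 'a poly set"
  let ?q = "[:-r, 1:]"
  let ?S = "\<lambda>v. {f \<in> ?P. ?q ^ v dvd f}"
  let ?B = "\<lambda>v. {f \<in> ?P. f \<noteq> 0 \<and> order r f = v}"
  have card_B: "card (?B v) = CARD('a) ^ (n - v) - CARD('a) ^ (n - Suc v)" if "v < n" for v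
  proof -
    have "?B v = ?S v - ?S (Suc v)" by (auto simp: order_divides simp del: power_Suc)
    moreover have "?S (Suc v) \<subseteq> ?S v" by (auto simp: order_divides simp del: power_Suc)
    ultimately have "card (?B v) = card (?S v) - card (?S (Suc v))"
      by (simp add: card_Diff_subset del: power_Suc)
    then show ?thesis using that by (simp add: card_polys_below_multiples del: power_Suc)
  qed
  \<comment> \<open>A nonzero polynomial of degree below \<open>n\<close> has order below \<open>n\<close>, so these pieces cover everything.\<close>
  have split: "{(f, g). f \<in> ?P \<and> g \<in> ?P \<and> ?q ^ n dvd f * g}
      = ({0} \<times> ?P) \<union> (\<Union>v<n. ?B v \<times> ?S (n - v))" (is "_ = _ \<union> ?U")
  proof (rule Set.set_eqI)
    fix x :: "'a poly \<times> 'a poly"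
    obtain f g where x: "x = (f, g)" by fastforce
    have "order r f < n" if "f \<in> ?P" "f \<noteq> 0"
      using that order_degree[of f r] by (auto simp: polys_below_def)
    then show "x \<in> {(f, g). f \<in> ?P \<and> g \<in> ?P \<and> ?q ^ n dvd f * g} \<longleftrightarrow> x \<in> ({0} \<times> ?P) \<union> ?U"
      by (cases "f = 0") (auto simp: x linear_power_dvd_mult_iff polys_below_iff_coeff)
  qed
  have "card ?U = (\<Sum>v<n. card (?B v \<times> ?S (n - v)))"
    by (rule card_UN_disjoint) auto
  also have "\<dots> = (\<Sum>v<n. CARD('a) ^ n - CARD('a) ^ (n - 1))"
  proof (rule sum.cong)
    fix v assume "v \<in> {..<n}"
    then have v: "v < n" by simp
    then have "card (?B v \<times> ?S (n - v)) = (CARD('a) ^ (n - v) - CARD('a) ^ (n - Suc v)) * CARD('a) ^ v"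
      by (simp only: card_cartesian_product card_B card_polys_below_multiples[OF diff_le_self])
         simp
    also have "\<dots> = CARD('a) ^ n - CARD('a) ^ (n - 1)"
      using v by (simp add: diff_mult_distrib flip: power_add)
    finally show "card (?B v \<times> ?S (n - v)) = CARD('a) ^ n - CARD('a) ^ (n - 1)" .
  qed simp
  finally have "card ?U = n * (CARD('a) ^ n - CARD('a) ^ (n - 1))" by simp
  moreover have "card ({0} \<times> ?P \<union> ?U) = card ({0::'a poly} \<times> ?P) + card ?U"
    by (rule card_Un_disjoint) auto
  ultimately show ?thesis by (simp add: split card_cartesian_product card_polys_below)
qed

section \<open>Cyclic convolution as multiplication modulo \<open>X\<^sup>n - 1\<close>\<close>

lemma X_power_minus_1_dvd_monom_diff_mod:
  "monom 1 n - 1 dvd (monom 1 m - monom 1 (m mod n) :: 'a::comm_ring_1 poly)"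
proof -
  have "monom 1 m - monom 1 (m mod n) = (monom 1 (m mod n) * (monom 1 n ^ (m div n) - 1) :: 'a poly)"
    by (simp add: monom_power mult_monom algebra_simps)
  moreover have "monom 1 n - 1 dvd (monom 1 n ^ (m div n) - 1 :: 'a poly)"
    by (simp add: power_diff_1_eq)
  ultimately show ?thesis by simp
qed

text \<open>
  Modulo \<open>X\<^sup>n - 1\<close> exponents may be reduced modulo \<open>n\<close>. Doing this in the product leaves a
  polynomial of degree below \<open>n\<close> whose coefficients are the cyclic convolution; being too short to be
  a nonzero multiple of \<open>X\<^sup>n - 1\<close>, it is divisible only if it vanishes.
\<close>
lemma X_power_minus_1_dvd_mult_iff:
  fixes b c :: "nat \<Rightarrow> 'a::idom"
  shows "monom 1 n - 1 dvd poly_of_vec n b * poly_of_vec n c \<longleftrightarrow>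
    (\<forall>l<n. (\<Sum>(j, k) \<in> {(j, k). j < n \<and> k < n \<and> [j + k = l] (mod n)}. b k * c j) = 0)"
proof (cases "n = 0")
  case False
  let ?M = "monom 1 n - 1 :: 'a poly"
  let ?I = "{..<n} \<times> {..<n}"
  let ?conv = "\<lambda>l. \<Sum>(j, k) \<in> {(j, k). j < n \<and> k < n \<and> [j + k = l] (mod n)}. b k * c j"
  define R where "R = (\<Sum>(j, k)\<in>?I. monom (b k * c j) ((j + k) mod n))"
  have "poly_of_vec n b * poly_of_vec n c = poly_of_vec n c * poly_of_vec n b"
    by (rule mult.commute)
  also have "\<dots> = (\<Sum>(j, k)\<in>?I. monom (b k * c j) (j + k))"
    unfolding poly_of_vec_def sum_product mult_monom sum.cartesian_product
    by (simp add: mult.commute)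
  finally have "poly_of_vec n b * poly_of_vec n c = (\<Sum>(j, k)\<in>?I. monom (b k * c j) (j + k))" .
  then have "poly_of_vec n b * poly_of_vec n c - R =
      (\<Sum>(j, k)\<in>?I. smult (b k * c j) (monom 1 (j + k) - monom 1 ((j + k) mod n)))"
    by (simp add: R_def case_prod_beta smult_diff_right smult_monom flip: sum_subtractf)
  also have "?M dvd \<dots>"
    by (auto intro!: dvd_sum dvd_smult X_power_minus_1_dvd_monom_diff_mod)
  finally have "?M dvd poly_of_vec n b * poly_of_vec n c \<longleftrightarrow> ?M dvd R"
    by (metis dvd_diff_right_iff dvd_diff_left_iff)
  moreover have coeff_R: "coeff R l = (if l < n then ?conv l else 0)" for l
  proof -
    have "coeff R l = (\<Sum>(j, k)\<in>?I. if (j + k) mod n = l then b k * c j else 0)"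
      by (simp add: R_def coeff_sum case_prod_beta coeff_monom)
    also have "\<dots> = (\<Sum>(j, k)\<in>{x\<in>?I. (fst x + snd x) mod n = l}. b k * c j)"
      by (subst sum.inter_filter) (auto intro!: sum.cong)
    also have "\<dots> = (if l < n then ?conv l else 0)"
    proof (cases "l < n")
      case True
      then show ?thesis by (auto simp: cong_def intro!: sum.cong)
    next
      case l: False
      have "{x\<in>?I. (fst x + snd x) mod n = l} = {}" using l False mod_less_divisor by fastforce
      then show ?thesis using l by (simp only: sum.empty if_False)
    qed
    finally show ?thesis .
  qed
  moreover have "?M dvd R \<longleftrightarrow> R = 0"
  proof
    assume "?M dvd R"
    have "degree ?M = n"
      using False by (subst diff_conv_add_uminus, subst degree_add_eq_left) (auto simp: degree_monom_eq)
    moreover have "R \<in> polys_below n" by (simp add: polys_below_iff_coeff coeff_R)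
    ultimately show "R = 0" using dvd_imp_degree_le[OF \<open>?M dvd R\<close>]
      by (cases "R = 0") (auto simp: polys_below_def)
  qed simp
  ultimately show ?thesis by (auto simp: poly_eq_iff)
qed (simp add: poly_of_vec_def)

text \<open>By the freshman's dream, applied to \<open>X = (X - 1) + 1\<close>.\<close>
lemma X_power_CHAR_minus_1:
  assumes "prime CHAR('a::comm_ring_1)"
  shows "monom 1 CHAR('a) - 1 = [:-1, 1 :: 'a:] ^ CHAR('a)"
proof -
  have "([:-1, 1:] + 1 :: 'a poly) ^ CHAR('a) = [:-1, 1:] ^ CHAR('a) + 1"
    using freshmans_dream[where x = "[:-1, 1 :: 'a:]" and y = 1] assms by simp
  moreover have "([:-1, 1:] + 1 :: 'a poly) = monom 1 1" by (simp add: monom_altdef one_pCons)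
  ultimately show ?thesis by (simp add: monom_power)
qed

section \<open>Counting through bijections\<close>

text \<open>A triangular change of variables: the bijection used in one coordinate may depend on the other.\<close>
lemma bij_betw_fibrewise:
  assumes f: "bij_betw f B Q" and g: "\<And>b. bij_betw (\<lambda>a. g a b) A P"
  shows "bij_betw (\<lambda>(a, b). (f b, g a b)) (A \<times> B) (Q \<times> P)"
proof (rule bij_betw_imageI)
  show "inj_on (\<lambda>(a, b). (f b, g a b)) (A \<times> B)"
  proof (rule inj_onI, clarify)
    fix a b a' b'
    assume V: "a \<in> A" "b \<in> B" "a' \<in> A" "b' \<in> B" and eq: "f b = f b'" "g a b = g a' b'"
    have "b = b'" using inj_onD[OF bij_betw_imp_inj_on[OF f] eq(1)] V by simp
    then show "a = a' \<and> b = b'" using inj_onD[OF bij_betw_imp_inj_on[OF g[of b]]] eq(2) V by simp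
  qed
  show "(\<lambda>(a, b). (f b, g a b)) ` (A \<times> B) = Q \<times> P"
  proof (intro equalityI subsetI)
    fix x assume "x \<in> Q \<times> P"
    then obtain y z where x: "x = (y, z)" "y \<in> Q" "z \<in> P" by auto
    obtain b where b: "b \<in> B" "f b = y" using x(2) bij_betw_imp_surj_on[OF f] by blast
    obtain a where "a \<in> A" "g a b = z" using x(3) bij_betw_imp_surj_on[OF g[of b]] by blast
    then show "x \<in> (\<lambda>(a, b). (f b, g a b)) ` (A \<times> B)" using b x(1) by force
  qed (use bij_betwE[OF f] bij_betwE[OF g] in auto)
qed

lemma card_preimage_bij_betw:
  assumes "bij_betw F X Y" and "D \<subseteq> Y"
  shows "card {x \<in> X. F x \<in> D} = card D"
proof -
  have "F ` {x \<in> X. F x \<in> D} = D"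
    using assms(2) bij_betw_imp_surj_on[OF assms(1)] by blast
  then have "bij_betw F {x \<in> X. F x \<in> D} D"
    by (intro bij_betw_subset[OF assms(1)]) auto
  then show ?thesis by (rule bij_betw_same_card)
qed

section \<open>The quadratic system\<close>

text \<open>
  As a group algebra element this is \<open>a\<^sub>0 + D a - E b\<close>, where \<open>D\<close> and \<open>E\<close> are the linear maps with
  \<open>D g\<^sup>j = j g\<^sup>j\<close> and \<open>E g\<^sup>j = (j + 1 choose 2) g\<^sup>j\<close>. It is restricted to \<open>{..<n}\<close> so that it is
  again an extensional vector.
\<close>
definition cofactor_vec :: "nat \<Rightarrow> (nat \<Rightarrow> 'a) \<Rightarrow> (nat \<Rightarrow> 'a) \<Rightarrow> nat \<Rightarrow> 'a::comm_ring_1" where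
  "cofactor_vec n a b = (\<lambda>j\<in>{..<n}.
     (if j = 0 then a 0 else of_nat j * a j) - of_nat ((j + 1) choose 2) * b j)"

text \<open>
  The index pairs with \<open>j = 0\<close> reduce to \<open>(0, l)\<close>. There the factor \<open>j a\<^sub>j\<close> vanishes, and the extra term
  \<open>a\<^sub>0 b\<^sub>l\<close> can be absorbed in its place.
\<close>
lemma system_eq_conv_cofactor_vec:
  fixes a b :: "nat \<Rightarrow> 'a::comm_ring_1"
  assumes "l < n"
  shows "a 0 * b l + (\<Sum>(j, k) \<in> {(j, k). j < n \<and> k < n \<and> [j + k = l] (mod n)}.
           b k * (- of_nat ((j + 1) choose 2) * b j + of_nat j * a j))
       = (\<Sum>(j, k) \<in> {(j, k). j < n \<and> k < n \<and> [j + k = l] (mod n)}. b k * cofactor_vec n a b j)"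
proof -
  let ?J = "{(j, k). j < n \<and> k < n \<and> [j + k = l] (mod n)}"
  have fin: "finite ?J" by (rule finite_subset[of _ "{..<n} \<times> {..<n}"]) auto
  have 0: "(0, l) \<in> ?J" using assms by simp
  have "a 0 * b l = (\<Sum>x\<in>?J. if x = (0, l) then a 0 * b l else 0)"
    using fin 0 by (simp only: sum.delta if_True)
  then have "a 0 * b l + (\<Sum>(j, k)\<in>?J. b k * (- of_nat ((j + 1) choose 2) * b j + of_nat j * a j))
      = (\<Sum>x\<in>?J. (if x = (0, l) then a 0 * b l else 0) +
          (case x of (j, k) \<Rightarrow> b k * (- of_nat ((j + 1) choose 2) * b j + of_nat j * a j)))"
    by (simp only: sum.distrib)
  also have "\<dots> = (\<Sum>(j, k)\<in>?J. b k * cofactor_vec n a b j)"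
  proof (rule sum.cong[OF refl], clarify)
    fix j k assume jk: "j < n" "k < n" "[j + k = l] (mod n)"
    have "k = l" if "j = 0" using jk assms that by (simp add: cong_def)
    then show "(if (j, k) = (0, l) then a 0 * b l else 0)
        + b k * (- of_nat ((j + 1) choose 2) * b j + of_nat j * a j) = b k * cofactor_vec n a b j"
      using jk by (auto simp: cofactor_vec_def algebra_simps)
  qed
  finally show ?thesis .
qed

text \<open>
  For fixed \<open>b\<close> the map is affine in \<open>a\<close> with a diagonal linear part whose entries are \<open>1\<close> (at \<open>j = 0\<close>)
  and \<open>j\<close>, all invertible.
\<close>
lemma bij_betw_cofactor_vec:
  fixes b :: "nat \<Rightarrow> 'a::field"
  assumes "\<And>j. 0 < j \<Longrightarrow> j < n \<Longrightarrow> of_nat j \<noteq> (0 :: 'a)"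
  shows "bij_betw (\<lambda>a. cofactor_vec n a b) ({..<n} \<rightarrow>\<^sub>E UNIV) ({..<n} \<rightarrow>\<^sub>E UNIV)"
proof (rule bij_betw_byWitness[where f' = "\<lambda>c. \<lambda>j\<in>{..<n}.
    (c j + of_nat ((j + 1) choose 2) * b j) / (if j = 0 then 1 else of_nat j)"])
  show "\<forall>a\<in>{..<n} \<rightarrow>\<^sub>E UNIV. (\<lambda>j\<in>{..<n}. (cofactor_vec n a b j + of_nat ((j + 1) choose 2) * b j)
      / (if j = 0 then 1 else of_nat j)) = a"
    using assms by (auto simp: cofactor_vec_def fun_eq_iff PiE_def extensional_def)
  show "\<forall>c\<in>{..<n} \<rightarrow>\<^sub>E UNIV. cofactor_vec n (\<lambda>j\<in>{..<n}. (c j + of_nat ((j + 1) choose 2) * b j)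
      / (if j = 0 then 1 else of_nat j)) b = c"
    using assms by (auto simp: cofactor_vec_def fun_eq_iff PiE_def extensional_def)
qed (simp_all add: image_subset_iff cofactor_vec_def)

theorem proposition8p1:
  fixes p :: nat
  assumes "p = CARD('p::prime_card)" and "odd p"
  shows "card {(a, b). a \<in> {..<p} \<rightarrow>\<^sub>E (UNIV :: 'p mod_ring set) \<and>
           b \<in> {..<p} \<rightarrow>\<^sub>E (UNIV :: 'p mod_ring set) \<and>
           (\<forall>l<p. 0 = a 0 * b l +
              (\<Sum>(j, k) \<in> {(j, k). j < p \<and> k < p \<and> [j + k = l] (mod p)}.
                 b k * (- of_nat ((j + 1) choose 2) * b j + of_nat j * a j)))}
         = p ^ (p + 1)"
proof -
  let ?V = "{..<p} \<rightarrow>\<^sub>E (UNIV :: 'p mod_ring set)"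
  let ?P = "polys_below p :: 'p mod_ring poly set"
  let ?q = "[:-1, 1:] :: 'p mod_ring poly"
  let ?\<Phi> = "poly_of_vec p :: _ \<Rightarrow> 'p mod_ring poly"
  let ?D = "{(f, g). f \<in> ?P \<and> g \<in> ?P \<and> ?q ^ p dvd f * g}"
  have CHAR: "CHAR('p mod_ring) = p" using assms(1) by simp
  have p: "prime p" using assms(1) prime_card by simp
  have X: "monom 1 p - 1 = ?q ^ p"
    using X_power_CHAR_minus_1[where 'a = "'p mod_ring"] p unfolding CHAR .
  have solution_iff: "(\<forall>l<p. 0 = a 0 * b l +
              (\<Sum>(j, k) \<in> {(j, k). j < p \<and> k < p \<and> [j + k = l] (mod p)}.
                 b k * (- of_nat ((j + 1) choose 2) * b j + of_nat j * a j)))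
      \<longleftrightarrow> ?q ^ p dvd ?\<Phi> b * ?\<Phi> (cofactor_vec p a b)" for a b :: "nat \<Rightarrow> 'p mod_ring"
    unfolding X[symmetric] X_power_minus_1_dvd_mult_iff
    by (intro all_cong1 imp_cong refl, simp only: system_eq_conv_cofactor_vec, rule eq_commute)
  have nz: "of_nat j \<noteq> (0 :: 'p mod_ring)" if "0 < j" "j < p" for j
    using that CHAR by (metis of_nat_eq_0_iff_char_dvd nat_dvd_not_less)
  have fibre: "bij_betw (\<lambda>a. ?\<Phi> (cofactor_vec p a b)) ?V ?P" for b
  proof -
    have "bij_betw (\<lambda>a. cofactor_vec p a b) ?V ?V"
      by (rule bij_betw_cofactor_vec) (rule nz)
    from bij_betw_trans[OF this bij_betw_poly_of_vec] show ?thesis by (simp only: comp_def)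
  qed
  let ?F = "\<lambda>(a, b). (?\<Phi> b, ?\<Phi> (cofactor_vec p a b))"
  have "bij_betw ?F (?V \<times> ?V) (?P \<times> ?P)"
    by (rule bij_betw_fibrewise[OF bij_betw_poly_of_vec fibre])
  moreover have "?D \<subseteq> ?P \<times> ?P" by blast
  ultimately have "card {x \<in> ?V \<times> ?V. ?F x \<in> ?D} = card ?D" by (rule card_preimage_bij_betw)
  also have "{x \<in> ?V \<times> ?V. ?F x \<in> ?D} =
      {(a, b). a \<in> ?V \<and> b \<in> ?V \<and> ?q ^ p dvd ?\<Phi> b * ?\<Phi> (cofactor_vec p a b)}"
    by (rule Set.set_eqI) (simp add: poly_of_vec_in_polys_below case_prod_beta mem_Times_iff)
  also have "card ?D = p ^ p + p * (p ^ p - p ^ (p - 1))"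
    unfolding card_pairs_linear_power_dvd_mult by (simp flip: assms(1))
  also have "\<dots> = p ^ (p + 1)"
    using prime_gt_0_nat[OF p] by (cases p) (simp_all add: algebra_simps)
  finally show ?thesis unfolding solution_iff .
qed

end
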